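(* Let $M,N,K$ be positive integers, $\mathbf A\in\mathbb R^{M\times N}$ with $\mathbf A\ne\mathbf 0$, $\lambda>0$, $\lambda_1>0$, $c_1=3$, $c_2=\|\mathbf A\|_F$. On $\mathbb R^{M\times K}\times\mathbb R^{K\times N}$ let $g(\mathbf U,\mathbf Z)=\frac12\|\mathbf A-\mathbf U\mathbf Z\|_F^2$, $f(\mathbf U,\mathbf Z)=\lambda_1(\|\mathbf U\|_1+\|\mathbf Z\|_1)$, and $$h(\mathbf U,\mathbf Z)=c_1\Big(\tfrac{\|\mathbf U\|_F^2+\|\mathbf Z\|_F^2}{2}\Big)^2+c_2\,\tfrac{\|\mathbf U\|_F^2+\|\mathbf Z\|_F^2}{2}.$$ Then the BPG-MF update $(\mathbf U^{k+1},\mathbf Z^{k+1})$ from $(\mathbf U^k,\mathbf Z^k)$ is given by $$\mathbf U^{k+1}=r\,\mathcal S_{\lambda_1\lambda}(-\mathbf P^k),\qquad \mathbf Z^{k+1}=r\,\mathcal S_{\lambda_1\lambda}(-\mathbf Q^k),$$ where $r\ge 0$ satisfies $$c_1\big(\|\mathcal S_{\lambda_1\lambda}(-\mathbf Q^k)\|_F^2+\|\mathcal S_{\lambda_1\lambda}(-\mathbf P^k)\|_F^2\big)r^3+c_2r-1=0 .$$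
   Context: $\|\cdot\|_F$ and $\langle\cdot,\cdot\rangle$ are the Frobenius norm and inner product; $\|\mathbf X\|_1=\sum_{i,j}|\mathbf X_{ij}|$. The soft-thresholding operator with parameter $\theta>0$ is applied entrywise: $\mathcal S_\theta(y)=\max\{|y|-\theta,0\}\,\mathrm{sgn}(y)$. BPG-MF update: given $\lambda>0$, functions $f,g,h$ on $\mathbb R^{M\times K}\times\mathbb R^{K\times N}$ with $g,h$ differentiable, and a current iterate $(\mathbf U^k,\mathbf Z^k)\in\mathbb R^{M\times K}\times\mathbb R^{K\times N}$, put $\mathbf P^k=\lambda\nabla_{\mathbf U}g(\mathbf U^k,\mathbf Z^k)-\nabla_{\mathbf U}h(\mathbf U^k,\mathbf Z^k)$ and $\mathbf Q^k=\lambda\nabla_{\mathbf Z}g(\mathbf U^k,\mathbf Z^k)-\nabla_{\mathbf Z}h(\mathbf U^k,\mathbf Z^k)$; the update is $$(\mathbf U^{k+1},\mathbf Z^{k+1})\in\operatorname*{argmin}_{(\mathbf U,\mathbf Z)\in\mathbb R^{M\times K}\times\mathbb R^{K\times N}}\{\lambda f(\mathbf U,\mathbf Z)+\langle\mathbf P^k,\mathbf U\rangle+\langle\mathbf Q^k,\mathbf Z\rangle+h(\mathbf U,\mathbf Z)\}.$$ *)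

theory Defs
  imports "HOL-Analysis.Analysis"
begin

text \<open>
  An \<open>m \<times> n\<close> real matrix has type \<open>real^'n^'m\<close>.  On this type \<open>norm\<close> and \<open>inner\<close>
  are the Frobenius norm and the Frobenius inner product:
\<close>

lemma inner_matrix_Frobenius:
  fixes X Y :: "real^'n^'m"
  shows "X \<bullet> Y = (\<Sum>i\<in>UNIV. \<Sum>j\<in>UNIV. X $ i $ j * Y $ i $ j)"
  by (simp add: inner_vec_def)

lemma norm_matrix_Frobenius:
  fixes X :: "real^'n^'m"
  shows "norm X = sqrt (\<Sum>i\<in>UNIV. \<Sum>j\<in>UNIV. (X $ i $ j)\<^sup>2)"
  by (simp add: norm_eq_sqrt_inner inner_vec_def power2_eq_square)

definition matrix_l1_norm :: "real^'n^'m \<Rightarrow> real" where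
  "matrix_l1_norm X = (\<Sum>i\<in>UNIV. \<Sum>j\<in>UNIV. \<bar>X $ i $ j\<bar>)"

definition soft_threshold :: "real \<Rightarrow> real \<Rightarrow> real" where
  "soft_threshold \<theta> y = max (\<bar>y\<bar> - \<theta>) 0 * sgn y"

definition matrix_soft_threshold :: "real \<Rightarrow> real^'n^'m \<Rightarrow> real^'n^'m" where
  "matrix_soft_threshold \<theta> X = map_matrix (soft_threshold \<theta>) X"

text \<open>The value is unspecified where the function is not differentiable.\<close>

definition gradient :: "('a::real_inner \<Rightarrow> real) \<Rightarrow> 'a \<Rightarrow> 'a" where
  "gradient f x = (THE D. GDERIV f x :> D)"

lemma gradient_eqI:
  assumes "GDERIV f x :> D"
  shows "gradient f x = D"
  unfolding gradient_def
proof (rule the_equality)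
  fix D' assume "GDERIV f x :> D'"
  with assms have "(\<lambda>v. v \<bullet> D') = (\<lambda>v. v \<bullet> D)"
    unfolding gderiv_def by (rule has_derivative_unique[rotated])
  then have "\<And>v. v \<bullet> D' = v \<bullet> D"
    by meson
  then show "D' = D"
    by (metis vector_eq_ldot)
qed (fact assms)

definition gradient_fst ::
    "('a::real_inner \<times> 'b::real_inner \<Rightarrow> real) \<Rightarrow> 'a \<times> 'b \<Rightarrow> 'a" where
  "gradient_fst F = (\<lambda>(u, z). gradient (\<lambda>u'. F (u', z)) u)"

definition gradient_snd ::
    "('a::real_inner \<times> 'b::real_inner \<Rightarrow> real) \<Rightarrow> 'a \<times> 'b \<Rightarrow> 'b" where
  "gradient_snd F = (\<lambda>(u, z). gradient (\<lambda>z'. F (u, z')) z)"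

text \<open>
  Bregman proximal gradient for matrix factorization (BPG-MF), for an objective \<open>f + g\<close>
  with kernel generating distance \<open>h\<close> and step size \<open>lam\<close>.
\<close>

definition bpg_P ::
    "real \<Rightarrow> ((real^'k^'m) \<times> (real^'n^'k) \<Rightarrow> real) \<Rightarrow> ((real^'k^'m) \<times> (real^'n^'k) \<Rightarrow> real)
      \<Rightarrow> (real^'k^'m) \<times> (real^'n^'k) \<Rightarrow> real^'k^'m" where
  "bpg_P lam g h x = lam *\<^sub>R gradient_fst g x - gradient_fst h x"

definition bpg_Q ::
    "real \<Rightarrow> ((real^'k^'m) \<times> (real^'n^'k) \<Rightarrow> real) \<Rightarrow> ((real^'k^'m) \<times> (real^'n^'k) \<Rightarrow> real)
      \<Rightarrow> (real^'k^'m) \<times> (real^'n^'k) \<Rightarrow> real^'n^'k" where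
  "bpg_Q lam g h x = lam *\<^sub>R gradient_snd g x - gradient_snd h x"

text \<open>The update is set-valued: the set of all admissible next iterates from \<open>x\<close>.\<close>

definition bpg_mf_update ::
    "real \<Rightarrow> ((real^'k^'m) \<times> (real^'n^'k) \<Rightarrow> real) \<Rightarrow> ((real^'k^'m) \<times> (real^'n^'k) \<Rightarrow> real)
      \<Rightarrow> ((real^'k^'m) \<times> (real^'n^'k) \<Rightarrow> real)
      \<Rightarrow> (real^'k^'m) \<times> (real^'n^'k) \<Rightarrow> ((real^'k^'m) \<times> (real^'n^'k)) set" where
  "bpg_mf_update lam f g h x =
     {y. is_arg_min
           (\<lambda>(U, Z). lam * f (U, Z) + bpg_P lam g h x \<bullet> U + bpg_Q lam g h x \<bullet> Z + h (U, Z))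
           (\<lambda>_. True) y}"

definition mf_loss :: "real^'n^'m \<Rightarrow> (real^'k^'m) \<times> (real^'n^'k) \<Rightarrow> real" where
  "mf_loss A = (\<lambda>(U, Z). 1 / 2 * (norm (A - U ** Z))\<^sup>2)"

definition mf_l1_reg :: "real \<Rightarrow> (real^'k^'m) \<times> (real^'n^'k) \<Rightarrow> real" where
  "mf_l1_reg lam1 = (\<lambda>(U, Z). lam1 * (matrix_l1_norm U + matrix_l1_norm Z))"

definition mf_kernel :: "real \<Rightarrow> real \<Rightarrow> (real^'k^'m) \<times> (real^'n^'k) \<Rightarrow> real" where
  "mf_kernel c1 c2 = (\<lambda>(U, Z).
     c1 * (((norm U)\<^sup>2 + (norm Z)\<^sup>2) / 2)\<^sup>2 + c2 * (((norm U)\<^sup>2 + (norm Z)\<^sup>2) / 2))"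

end

theory Submission
  imports Defs
begin

text \<open>
  Write \<open>W = (U, Z)\<close>, \<open>S = (SP, SQ)\<close> and \<open>\<theta> = lam1 * lam\<close>.  The norm of the product space satisfies
  \<open>\<parallel>W\<parallel>\<^sup>2 = \<parallel>U\<parallel>\<^sup>2 + \<parallel>Z\<parallel>\<^sup>2\<close>, so \<open>h\<close> is the radial function
  \<open>\<phi> W = c1 * (\<parallel>W\<parallel>\<^sup>2 / 2)\<^sup>2 + c2 * (\<parallel>W\<parallel>\<^sup>2 / 2)\<close>.  Two facts about the objective of the update combine.

  \<^item> Soft thresholding linearises the \<open>\<ell>\<^sub>1\<close> part.  For an entry \<open>y\<close> of \<open>- P\<close> or \<open>- Q\<close>, the convex
    function \<open>u \<mapsto> \<theta> * \<bar>u\<bar> - y * u\<close> lies above the linear function \<open>- soft_threshold \<theta> y * u\<close>, and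
    the two agree at all nonnegative multiples of \<open>soft_threshold \<theta> y\<close>.  Hence the objective is at
    least \<open>\<phi> W - S \<bullet> W\<close>, with equality at all nonnegative multiples of \<open>S\<close>
    (\<open>matrix_soft_threshold_support\<close>, \<open>matrix_soft_threshold_attained\<close>).

  \<^item> The gradient of \<open>\<phi>\<close> at \<open>W\<close> is \<open>(c1 * \<parallel>W\<parallel>\<^sup>2 + c2) *\<^sub>R W\<close>.  At \<open>W = r *\<^sub>R S\<close> it equals \<open>S\<close>
    as soon as \<open>r\<close> solves the cubic, so this point, where the bound is attained, is critical for
    \<open>\<phi> W - S \<bullet> W\<close>.  As \<open>\<phi>\<close> is strongly convex with modulus \<open>c2\<close>, the value at any \<open>W\<close> exceeds
    the value there by at least \<open>c2 / 2 * \<parallel>W - r *\<^sub>R S\<parallel>\<^sup>2\<close> (\<open>quartic_kernel_tilted_minimum\<close>).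

  So \<open>r *\<^sub>R S\<close> is the unique minimiser.  The hypothesis \<open>A \<noteq> 0\<close> makes \<open>c2 = norm A\<close> positive, which
  gives both the strict gap and the root of the cubic, even when \<open>S = 0\<close>.
\<close>

lemma soft_threshold_support:
  assumes "\<theta> \<ge> 0"
  shows "y * u - \<theta> * \<bar>u\<bar> \<le> soft_threshold \<theta> y * u"
proof -
  have *: "\<theta> * u \<le> \<theta> * \<bar>u\<bar>" "- (\<theta> * u) \<le> \<theta> * \<bar>u\<bar>"
    using assms mult_left_mono[of u "\<bar>u\<bar>" \<theta>] mult_left_mono[of "-u" "\<bar>u\<bar>" \<theta>] by auto
  have **: "y * u \<le> \<theta> * \<bar>u\<bar>" if "\<bar>y\<bar> \<le> \<theta>"
    using mult_right_mono[OF that, of "\<bar>u\<bar>"] abs_ge_self[of "y * u"] by (simp add: abs_mult)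
  show ?thesis
    using * ** by (auto simp: soft_threshold_def max_def sgn_if algebra_simps abs_if[of y]
        split: if_splits)
qed

text \<open>
  A nonzero threshold \<open>soft_threshold \<theta> y\<close> is \<open>y\<close> shifted by \<open>\<theta>\<close> towards zero and keeps the sign
  of \<open>y\<close>.  The bound above is tight where \<open>u\<close> has that sign too, hence the restriction to
  nonnegative multiples.
\<close>

lemma soft_threshold_attained:
  assumes "\<theta> \<ge> 0" "r \<ge> 0"
  shows "y * (r * soft_threshold \<theta> y) - \<theta> * \<bar>r * soft_threshold \<theta> y\<bar>
    = soft_threshold \<theta> y * (r * soft_threshold \<theta> y)"
  using assms by (auto simp: soft_threshold_def max_def sgn_if algebra_simps abs_mult)

lemma matrix_soft_threshold_nth:
  "matrix_soft_threshold \<theta> Y $ i $ j = soft_threshold \<theta> (Y $ i $ j)"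
  by (simp add: matrix_soft_threshold_def map_matrix_def)

lemma inner_minus_matrix_l1_norm:
  fixes X Y :: "real^'n^'m"
  shows "Y \<bullet> X - \<theta> * matrix_l1_norm X
    = (\<Sum>i\<in>UNIV. \<Sum>j\<in>UNIV. Y $ i $ j * X $ i $ j - \<theta> * \<bar>X $ i $ j\<bar>)"
  by (simp add: inner_matrix_Frobenius matrix_l1_norm_def sum_subtractf sum_distrib_left)

lemma matrix_soft_threshold_support:
  assumes "\<theta> \<ge> 0"
  shows "Y \<bullet> X - \<theta> * matrix_l1_norm X \<le> matrix_soft_threshold \<theta> Y \<bullet> X"
  unfolding inner_minus_matrix_l1_norm inner_matrix_Frobenius[of "matrix_soft_threshold \<theta> Y"]
    matrix_soft_threshold_nth
  by (intro sum_mono soft_threshold_support assms)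

lemma matrix_soft_threshold_attained:
  assumes "\<theta> \<ge> 0" "r \<ge> 0"
  shows "Y \<bullet> (r *\<^sub>R matrix_soft_threshold \<theta> Y) - \<theta> * matrix_l1_norm (r *\<^sub>R matrix_soft_threshold \<theta> Y)
    = matrix_soft_threshold \<theta> Y \<bullet> (r *\<^sub>R matrix_soft_threshold \<theta> Y)"
  unfolding inner_minus_matrix_l1_norm inner_matrix_Frobenius[of "matrix_soft_threshold \<theta> Y"]
  using assms by (simp add: matrix_soft_threshold_nth soft_threshold_attained)

text \<open>
  On pairs of matrices this is \<open>mf_kernel\<close>; the general form lets the convexity argument treat the
  two blocks as one vector.
\<close>

definition quartic_kernel :: "real \<Rightarrow> real \<Rightarrow> 'a::real_inner \<Rightarrow> real" where
  "quartic_kernel c1 c2 W = c1 * ((norm W)\<^sup>2 / 2)\<^sup>2 + c2 * ((norm W)\<^sup>2 / 2)"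

text \<open>
  The Bregman distance from \<open>V\<close> to \<open>W\<close> splits into two parts.  The \<open>c2\<close> part is exactly
  \<open>c2 / 2 * \<parallel>W - V\<parallel>\<^sup>2\<close>, so the bound amounts to the \<open>c1\<close> part being nonnegative.
  By \<open>2 * (V \<bullet> W) \<le> \<parallel>V\<parallel>\<^sup>2 + \<parallel>W\<parallel>\<^sup>2\<close>, that part is at least
  \<open>c1 / 4 * (\<parallel>W\<parallel>\<^sup>2 - \<parallel>V\<parallel>\<^sup>2)\<^sup>2\<close>.
\<close>

lemma quartic_kernel_strongly_convex:
  fixes V W :: "'a::real_inner"
  assumes "c1 \<ge> 0"
  shows "quartic_kernel c1 c2 W - quartic_kernel c1 c2 V
      - (c1 * (norm V)\<^sup>2 + c2) * (V \<bullet> (W - V)) \<ge> c2 / 2 * (norm (W - V))\<^sup>2"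
proof -
  define a b t where "a = (norm W)\<^sup>2" and "b = (norm V)\<^sup>2" and "t = V \<bullet> W"
  have gap: "(norm (W - V))\<^sup>2 = a + b - 2 * t" and tilt: "V \<bullet> (W - V) = t - b"
    by (simp_all add: a_def b_def t_def power2_norm_eq_inner inner_diff inner_commute)
  have "0 \<le> a + b - 2 * t"
    using gap by (metis zero_le_power2)
  then have "0 \<le> c1 * ((a - b)\<^sup>2 / 4 + b * (a + b - 2 * t) / 2)"
    using assms by (intro mult_nonneg_nonneg add_nonneg_nonneg) (auto simp: b_def)
  also have "\<dots> = c1 * (a / 2)\<^sup>2 + c2 * (a / 2) - (c1 * (b / 2)\<^sup>2 + c2 * (b / 2))
      - (c1 * b + c2) * (t - b) - c2 / 2 * (a + b - 2 * t)"
    by (simp add: field_simps power2_eq_square)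
  finally show ?thesis
    unfolding quartic_kernel_def gap tilt a_def[symmetric] b_def[symmetric] by simp
qed

lemma quartic_kernel_tilted_minimum:
  fixes S W :: "'a::real_inner"
  assumes "c1 \<ge> 0" and cubic: "c1 * (norm S)\<^sup>2 * r ^ 3 + c2 * r - 1 = 0"
  shows "quartic_kernel c1 c2 (r *\<^sub>R S) - S \<bullet> (r *\<^sub>R S) + c2 / 2 * (norm (W - r *\<^sub>R S))\<^sup>2
    \<le> quartic_kernel c1 c2 W - S \<bullet> W"
proof -
  \<comment> \<open>The cubic says that the gradient of the kernel at \<open>r *\<^sub>R S\<close> is \<open>S\<close>.\<close>
  have "(c1 * (norm (r *\<^sub>R S))\<^sup>2 + c2) * r = 1"
    using cubic by (simp add: power_mult_distrib algebra_simps power2_eq_square power3_eq_cube)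
  then have "(c1 * (norm (r *\<^sub>R S))\<^sup>2 + c2) * (r *\<^sub>R S \<bullet> (W - r *\<^sub>R S)) = S \<bullet> (W - r *\<^sub>R S)"
    by (metis inner_scaleR_left mult.assoc mult_1)
  then show ?thesis
    using quartic_kernel_strongly_convex[OF \<open>c1 \<ge> 0\<close>, of c2 W "r *\<^sub>R S"]
    by (simp only: inner_diff_right)
qed

lemma cubic_nonneg_root_exists:
  fixes a c :: real
  assumes "a \<ge> 0" "c > 0"
  shows "\<exists>r\<ge>0. a * r ^ 3 + c * r - 1 = 0"
proof -
  have "\<exists>r\<ge>0. r \<le> 1 / c \<and> a * r ^ 3 + c * r - 1 = 0"
    by (rule IVT') (use assms in \<open>auto intro!: continuous_intros\<close>)
  then show ?thesis by blast
qed

lemma is_arg_min_unique_if_gap: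
  fixes F :: "'a::real_normed_vector \<Rightarrow> real"
  assumes "c > 0" and gap: "\<And>W. F V + c * (norm (W - V))\<^sup>2 \<le> F W"
  shows "{W. is_arg_min F (\<lambda>_. True) W} = {V}"
proof -
  have min: "F V \<le> F W" for W
    using gap[of W] \<open>c > 0\<close> by (smt (verit) mult_nonneg_nonneg zero_le_power2)
  have "W = V" if "F W \<le> F V" for W
  proof -
    have "c * (norm (W - V))\<^sup>2 \<le> 0"
      using gap[of W] that by linarith
    then show ?thesis
      using \<open>c > 0\<close> by (simp add: mult_le_0_iff)
  qed
  with min show ?thesis
    by (fastforce simp: is_arg_min_linorder)
qed

theorem propositionC5:
  fixes A :: "real^'n^'m"
    and Uk :: "real^'k^'m" and Zk :: "real^'n^'k"
    and lam lam1 c1 c2 :: real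
    and f g h :: "(real^'k^'m) \<times> (real^'n^'k) \<Rightarrow> real"
    and P SP :: "real^'k^'m" and Q SQ :: "real^'n^'k"
  assumes "A \<noteq> 0"
    and "lam > 0" and "lam1 > 0"
    and "c1 = 3" and "c2 = norm A"
    and "g = mf_loss A" and "f = mf_l1_reg lam1" and "h = mf_kernel c1 c2"
    and "P = bpg_P lam g h (Uk, Zk)" and "Q = bpg_Q lam g h (Uk, Zk)"
    and "SP = matrix_soft_threshold (lam1 * lam) (- P)"
    and "SQ = matrix_soft_threshold (lam1 * lam) (- Q)"
  shows "(\<exists>r\<ge>0. c1 * ((norm SQ)\<^sup>2 + (norm SP)\<^sup>2) * r ^ 3 + c2 * r - 1 = 0) \<and>
    (\<forall>r\<ge>0. c1 * ((norm SQ)\<^sup>2 + (norm SP)\<^sup>2) * r ^ 3 + c2 * r - 1 = 0 \<longrightarrow>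
       bpg_mf_update lam f g h (Uk, Zk) = {(r *\<^sub>R SP, r *\<^sub>R SQ)})"
proof -
  define \<theta> where "\<theta> = lam1 * lam"
  define S where "S = (SP, SQ)"
  define F where "F = (\<lambda>(U, Z). lam * f (U, Z) + P \<bullet> U + Q \<bullet> Z + h (U, Z))"
  have "\<theta> \<ge> 0" "c1 \<ge> 0" "c2 > 0"
    using assms by (simp_all add: \<theta>_def)
  have SP: "SP = matrix_soft_threshold \<theta> (- P)" and SQ: "SQ = matrix_soft_threshold \<theta> (- Q)"
    using assms by (simp_all add: \<theta>_def)
  have norm_S: "(norm S)\<^sup>2 = (norm SQ)\<^sup>2 + (norm SP)\<^sup>2"
    by (simp add: S_def norm_Pair)
  have update: "bpg_mf_update lam f g h (Uk, Zk) = {W. is_arg_min F (\<lambda>_. True) W}"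
    using assms by (simp add: bpg_mf_update_def F_def)
  have F_eq: "F (U, Z) = quartic_kernel c1 c2 (U, Z)
      - ((- P) \<bullet> U - \<theta> * matrix_l1_norm U) - ((- Q) \<bullet> Z - \<theta> * matrix_l1_norm Z)" for U Z
    using assms
    by (simp add: F_def \<theta>_def mf_l1_reg_def mf_kernel_def quartic_kernel_def norm_Pair algebra_simps)
  have F_ge: "quartic_kernel c1 c2 W - S \<bullet> W \<le> F W" for W
  proof (cases W)
    case (Pair U Z)
    show ?thesis
      using matrix_soft_threshold_support[OF \<open>\<theta> \<ge> 0\<close>, of "- P" U]
        matrix_soft_threshold_support[OF \<open>\<theta> \<ge> 0\<close>, of "- Q" Z]
      unfolding Pair F_eq S_def SP[symmetric] SQ[symmetric] inner_Pair by linarith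
  qed
  have F_ray: "F (r *\<^sub>R S) = quartic_kernel c1 c2 (r *\<^sub>R S) - S \<bullet> (r *\<^sub>R S)" if "r \<ge> 0" for r
    using matrix_soft_threshold_attained[OF \<open>\<theta> \<ge> 0\<close> that, of "- P"]
      matrix_soft_threshold_attained[OF \<open>\<theta> \<ge> 0\<close> that, of "- Q"]
    unfolding S_def scaleR_Pair F_eq SP[symmetric] SQ[symmetric] inner_Pair by linarith
  show ?thesis
  proof (intro conjI allI impI)
    show "\<exists>r\<ge>0. c1 * ((norm SQ)\<^sup>2 + (norm SP)\<^sup>2) * r ^ 3 + c2 * r - 1 = 0"
      using \<open>c1 \<ge> 0\<close> \<open>c2 > 0\<close> by (intro cubic_nonneg_root_exists) auto
  next
    fix r :: real
    assume "r \<ge> 0" and cubic: "c1 * ((norm SQ)\<^sup>2 + (norm SP)\<^sup>2) * r ^ 3 + c2 * r - 1 = 0"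
    have "{W. is_arg_min F (\<lambda>_. True) W} = {r *\<^sub>R S}"
    proof (rule is_arg_min_unique_if_gap)
      show "c2 / 2 > 0"
        using \<open>c2 > 0\<close> by simp
      show "F (r *\<^sub>R S) + c2 / 2 * (norm (W - r *\<^sub>R S))\<^sup>2 \<le> F W" for W
        using quartic_kernel_tilted_minimum[OF \<open>c1 \<ge> 0\<close> cubic[folded norm_S], of W]
          F_ray[OF \<open>r \<ge> 0\<close>] F_ge[of W] by linarith
    qed
    then show "bpg_mf_update lam f g h (Uk, Zk) = {(r *\<^sub>R SP, r *\<^sub>R SQ)}"
      by (simp add: update S_def)
  qed
qed

end
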